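(* Assume $\mathrm{ZF}+\mathrm{DC}+\mathrm{AD}$. Let $\mathbf{Z},\mathbf{X}$ be represented spaces. A multivalued function $f:\mathbf{Z}\rightrightarrows\mathbf{X}$ is either continuous or satisfies $\neq_\mathbf{X}\leq_{\mathrm{W}}^* f$.
   Context: A multivalued function between represented spaces is continuous iff it has a continuous realizer on names. A represented space $\mathbf{Y}$ is multiretraceable if every computable partial $f:\subseteq\{0,1\}^\mathbb{N}\to\mathbf{Y}$ has a total computable extension; a completion of $\mathbf{X}$ is a computable embedding $\iota:\mathbf{X}\hookrightarrow\overline{\mathbf{X}}$ into a multiretraceable space. $\neq_\mathbf{X}:\overline{\mathbf{X}}\rightrightarrows\mathbf{X}$ is defined by $y\in\neq_\mathbf{X}(x)$ iff $x\neq\iota(y)$ (its Weihrauch degree does not depend on the completion chosen). Conventions: for $\mathbf{X}=\emptyset$, $\neq_\emptyset$ is taken to be the nowhere defined function $0$; for a singleton space $\mathbf{1}$, $\neq_{\mathbf{1}}$ is taken to be the artificial top element $\infty$ of the Weihrauch degrees. $g\leq_{\mathrm{W}}^* h$: there are continuous $H,K$ such that for every realizer $G$ of $h$, $p\mapsto K(p,G(H(p)))$ realizes $g$. *)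

theory Defs
  imports "HOL-Analysis.Analysis"
begin

type_synonym cantor = "nat \<Rightarrow> bool"

text \<open>
  Topologies are the library ones: \<^typ>\<open>bool\<close> and \<^typ>\<open>nat\<close> are discrete and
  function types carry the product topology.
\<close>

definition cont_partial :: "('a::topological_space \<rightharpoonup> 'b::topological_space) \<Rightarrow> bool" where
  "cont_partial F \<longleftrightarrow> continuous_on (dom F) (\<lambda>p. the (F p))"

text \<open>Mu-recursive function codes with an oracle; \<open>evals p c xs y\<close> means that the
  function with code \<open>c\<close> and oracle \<open>p\<close> is defined on \<open>xs\<close> with value \<open>y\<close>.\<close>

datatype code =
    Zero
  | Succ
  | Proj nat
  | Query
  | Comp code "code list"
  | Rec code code
  | Mu code

inductive evals :: "cantor \<Rightarrow> code \<Rightarrow> nat list \<Rightarrow> nat \<Rightarrow> bool" for p :: cantor where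
  "evals p Zero xs 0"
| "evals p Succ (x # xs) (Suc x)"
| "i < length xs \<Longrightarrow> evals p (Proj i) xs (xs ! i)"
| "evals p Query (x # xs) (of_bool (p x))"
| "length ys = length gs \<Longrightarrow> \<forall>i<length gs. evals p (gs ! i) xs (ys ! i) \<Longrightarrow> evals p f ys z
    \<Longrightarrow> evals p (Comp f gs) xs z"
| "evals p f xs y \<Longrightarrow> evals p (Rec f g) (0 # xs) y"
| "evals p (Rec f g) (n # xs) y \<Longrightarrow> evals p g (n # y # xs) z \<Longrightarrow> evals p (Rec f g) (Suc n # xs) z"
| "evals p f (n # xs) 0 \<Longrightarrow> \<forall>m<n. \<exists>k>0. evals p f (m # xs) k \<Longrightarrow> evals p (Mu f) xs n"

text \<open>A partial function is computable if some oracle program computes it on its domain;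
  nothing is required of the program outside the domain.\<close>

definition computable_partial :: "(cantor \<rightharpoonup> cantor) \<Rightarrow> bool" where
  "computable_partial F \<longleftrightarrow>
     (\<exists>c. \<forall>p q. F p = Some q \<longrightarrow> (\<forall>n. evals p c [n] (of_bool (q n))))"

text \<open>A represented space is given by its representation, a partial map from Cantor space;
  the underlying set is its range, so surjectivity is built in.\<close>

type_synonym 'a repspace = "cantor \<rightharpoonup> 'a"

abbreviation points :: "'a repspace \<Rightarrow> 'a set" where
  "points X \<equiv> ran X"

text \<open>Multivalued functions may be partial: the domain consists of the points with a
  nonempty set of values. Values of \<open>f\<close> outside \<open>points Z\<close> are irrelevant.\<close>

definition multivalued :: "'z repspace \<Rightarrow> 'x repspace \<Rightarrow> ('z \<Rightarrow> 'x set) \<Rightarrow> bool" where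
  "multivalued Z X f \<longleftrightarrow> (\<forall>z\<in>points Z. f z \<subseteq> points X)"

definition name_dom :: "'z repspace \<Rightarrow> ('z \<Rightarrow> 'x set) \<Rightarrow> cantor set" where
  "name_dom Z f = {p. \<exists>z. Z p = Some z \<and> f z \<noteq> {}}"

definition name_graph ::
    "'z repspace \<Rightarrow> 'x repspace \<Rightarrow> ('z \<Rightarrow> 'x set) \<Rightarrow> (cantor \<times> cantor) set" where
  "name_graph Z X f = {(p, q). \<exists>z x. Z p = Some z \<and> X q = Some x \<and> x \<in> f z}"

definition realizes ::
    "'z repspace \<Rightarrow> 'x repspace \<Rightarrow> ('z \<Rightarrow> 'x set) \<Rightarrow> (cantor \<rightharpoonup> cantor) \<Rightarrow> bool" where
  "realizes Z X f F \<longleftrightarrow> (\<forall>p\<in>name_dom Z f. \<exists>q. F p = Some q \<and> (p, q) \<in> name_graph Z X f)"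

definition mv_continuous :: "'z repspace \<Rightarrow> 'x repspace \<Rightarrow> ('z \<Rightarrow> 'x set) \<Rightarrow> bool" where
  "mv_continuous Z X f \<longleftrightarrow> (\<exists>F. cont_partial F \<and> realizes Z X f F)"

definition mv_computable :: "'z repspace \<Rightarrow> 'x repspace \<Rightarrow> ('z \<Rightarrow> 'x set) \<Rightarrow> bool" where
  "mv_computable Z X f \<longleftrightarrow> (\<exists>F. computable_partial F \<and> realizes Z X f F)"

definition cantor_space :: "cantor repspace" where
  "cantor_space = Some"

definition multiretraceable :: "'y repspace \<Rightarrow> bool" where
  "multiretraceable Y \<longleftrightarrow>
     (\<forall>f :: cantor \<rightharpoonup> 'y. ran f \<subseteq> points Y \<longrightarrow> mv_computable cantor_space Y (\<lambda>p. set_option (f p)) \<longrightarrow>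
        (\<exists>g :: cantor \<Rightarrow> 'y. range g \<subseteq> points Y \<and> mv_computable cantor_space Y (\<lambda>p. {g p}) \<and>
           (\<forall>p y. f p = Some y \<longrightarrow> g p = y)))"

definition computable_embedding :: "'x repspace \<Rightarrow> 'y repspace \<Rightarrow> ('x \<Rightarrow> 'y) \<Rightarrow> bool" where
  "computable_embedding X Y \<iota> \<longleftrightarrow>
     \<iota> ` points X \<subseteq> points Y \<and> inj_on \<iota> (points X) \<and>
     mv_computable X Y (\<lambda>x. {\<iota> x}) \<and>
     mv_computable Y X (\<lambda>y. {x \<in> points X. \<iota> x = y})"

definition is_completion :: "'x repspace \<Rightarrow> 'y repspace \<Rightarrow> ('x \<Rightarrow> 'y) \<Rightarrow> bool" where
  "is_completion X Xbar \<iota> \<longleftrightarrow> multiretraceable Xbar \<and> computable_embedding X Xbar \<iota>"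

text \<open>\<open>Infty\<close> is the artificial top element.\<close>

datatype ('a, 'b) problem =
    Problem "'a repspace" "'b repspace" "'a \<Rightarrow> 'b set"
  | Infty

fun weihrauch_le :: "('a, 'b) problem \<Rightarrow> ('c, 'd) problem \<Rightarrow> bool"
    (infix "\<le>\<^sub>W\<^sup>*" 50) where
  "_ \<le>\<^sub>W\<^sup>* Infty \<longleftrightarrow> True"
| "Infty \<le>\<^sub>W\<^sup>* Problem U V h \<longleftrightarrow> False"
| "Problem A B g \<le>\<^sub>W\<^sup>* Problem U V h \<longleftrightarrow>
     (\<exists>(H :: cantor \<rightharpoonup> cantor) (K :: cantor \<times> cantor \<rightharpoonup> cantor).
        cont_partial H \<and> cont_partial K \<and>
        (\<forall>G. realizes U V h G \<longrightarrow>
           realizes A B g (\<lambda>p. Option.bind (H p) (\<lambda>q. Option.bind (G q) (\<lambda>r. K (p, r))))))"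

text \<open>For \<open>points X = {}\<close> the second branch is the nowhere defined problem.\<close>

definition neq_problem :: "'x repspace \<Rightarrow> 'y repspace \<Rightarrow> ('x \<Rightarrow> 'y) \<Rightarrow> ('y, 'x) problem" where
  "neq_problem X Xbar \<iota> =
     (if is_singleton (points X) then Infty
      else Problem Xbar X (\<lambda>x. {y \<in> points X. x \<noteq> \<iota> y}))"

text \<open>In the game with payoff \<open>A\<close> two players alternately choose natural numbers; player I
  moves at even positions and wins iff the resulting sequence is in \<open>A\<close>.\<close>

definition determined :: "(nat \<Rightarrow> nat) set \<Rightarrow> bool" where
  "determined A \<longleftrightarrow>
     (\<exists>\<sigma> :: nat list \<Rightarrow> nat. \<forall>\<alpha>. (\<forall>n. \<alpha> (2 * n) = \<sigma> (map \<alpha> [0..<2 * n])) \<longrightarrow> \<alpha> \<in> A) \<or>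
     (\<exists>\<tau> :: nat list \<Rightarrow> nat. \<forall>\<alpha>. (\<forall>n. \<alpha> (2 * n + 1) = \<tau> (map \<alpha> [0..<2 * n + 1])) \<longrightarrow> \<alpha> \<notin> A)"

text \<open>
  The axiom of determinacy is \<open>determinacy UNIV\<close>. Since HOL has a choice operator, this
  instance is refutable, and a theorem assuming it would be vacuous. Determinacy is
  therefore relativised to a class \<open>\<Gamma>\<close> of subsets of Baire space that contains the
  multivalued function under consideration. For \<open>\<Gamma> = UNIV\<close> the requirements other than
  determinacy hold trivially (see the two lemmas below), so that instance is the
  statement under the unrestricted axiom.
\<close>

definition determinacy :: "(nat \<Rightarrow> nat) set set \<Rightarrow> bool" where
  "determinacy \<Gamma> \<longleftrightarrow> (\<forall>A\<in>\<Gamma>. determined A)"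

definition pointclass :: "(nat \<Rightarrow> nat) set set \<Rightarrow> bool" where
  "pointclass \<Gamma> \<longleftrightarrow> sigma_algebra UNIV \<Gamma> \<and> sets borel \<subseteq> \<Gamma> \<and>
     (\<forall>h \<in> borel_measurable borel. \<forall>A\<in>\<Gamma>. h -` A \<in> \<Gamma>)"

text \<open>Membership in \<open>\<Gamma>\<close> for subsets of spaces other than Baire space.\<close>

definition in_pointclass :: "(nat \<Rightarrow> nat) set set \<Rightarrow> 'a::topological_space set \<Rightarrow> bool" where
  "in_pointclass \<Gamma> R \<longleftrightarrow> (\<forall>h :: (nat \<Rightarrow> nat) \<Rightarrow> 'a. h \<in> borel_measurable borel \<longrightarrow> h -` R \<in> \<Gamma>)"

definition mv_in_pointclass ::
    "(nat \<Rightarrow> nat) set set \<Rightarrow> 'z repspace \<Rightarrow> 'x repspace \<Rightarrow> ('z \<Rightarrow> 'x set) \<Rightarrow> bool" where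
  "mv_in_pointclass \<Gamma> Z X f \<longleftrightarrow>
     in_pointclass \<Gamma> (name_dom Z f) \<and> in_pointclass \<Gamma> (name_graph Z X f)"

lemma pointclass_UNIV: "pointclass UNIV"
  using sigma_algebra_Pow[of UNIV] by (simp add: pointclass_def)

lemma mv_in_pointclass_UNIV: "mv_in_pointclass UNIV Z X f"
  by (simp add: mv_in_pointclass_def in_pointclass_def)

end

theory Submission
  imports Defs
begin

text \<open>
  Consider the Wadge game in which player I builds a name \<open>p\<close> bit by bit while player II, who
  may pass, enumerates the graph of a sequence \<open>q\<close>; player I wins iff \<open>p\<close> names a point of the
  domain of \<open>f\<close> and \<open>q\<close> fails to be a name of a value of \<open>f\<close> there. A winning strategy of II
  is a continuous realizer of \<open>f\<close>. Given a winning strategy of I and a name of \<open>y\<close> in the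
  completion, let II enumerate whatever the partial inverse of the embedding is already known
  to output. If \<open>y = \<iota> x\<close>, then II produces a name of \<open>x\<close>, so I has produced a name of some
  \<open>z\<close> with \<open>x \<notin> f z\<close>; hence every element of \<open>f z\<close> solves the inequality problem for \<open>y\<close>.
\<close>

section \<open>Finite use and determinism of oracle computations\<close>

lemma open_prefix_cylinder:
  fixes p :: "nat \<Rightarrow> 'a::discrete_topology"
  shows "open {p'. \<forall>i<N. p' i = p i}"
proof -
  have "{p'. \<forall>i<N. p' i = p i} = (\<Inter>i\<in>{..<N}. (\<lambda>p'. p' i) -` {p i})"
    by auto
  also have "open \<dots>"
    by (intro open_INT ballI open_vimage open_discrete) (auto intro: continuous_on_product_coordinates)
  finally show ?thesis .
qed

text \<open>In the product topology continuity is checked coordinatewise, and each coordinate is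
  locally constant on \<open>S\<close> because prefix cylinders are open.\<close>

lemma continuous_on_finite_use:
  fixes h :: "(nat \<Rightarrow> 'a::discrete_topology) \<Rightarrow> nat \<Rightarrow> 'b::topological_space"
  assumes "\<And>p k. p \<in> S \<Longrightarrow> \<exists>N. \<forall>p'\<in>S. (\<forall>i<N. p' i = p i) \<longrightarrow> h p' k = h p k"
  shows "continuous_on S h"
proof (rule continuous_on_coordinatewise_then_product)
  fix k
  show "continuous_on S (\<lambda>p. h p k)"
    unfolding continuous_on_def
  proof
    fix p assume "p \<in> S"
    then obtain N where N: "\<forall>p'\<in>S. (\<forall>i<N. p' i = p i) \<longrightarrow> h p' k = h p k"
      using assms by meson
    have "p \<in> {p'. \<forall>i<N. p' i = p i}"
      by simp
    then have "eventually (\<lambda>p'. h p' k = h p k) (at p within S)"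
      unfolding eventually_at_topological using open_prefix_cylinder[of N p] N by blast
    then show "((\<lambda>p. h p k) \<longlongrightarrow> h p k) (at p within S)"
      by (rule tendsto_eventually)
  qed
qed

text \<open>A derivation of \<open>evals\<close> is well founded and finitely branching, so it makes
  only finitely many oracle queries; the bounds of its premises combine into one.\<close>

lemma evals_finite_use:
  assumes "evals p c xs y"
  shows "\<exists>N. \<forall>p'. (\<forall>i<N. p' i = p i) \<longrightarrow> evals p' c xs y"
  using assms
proof induction
  case (4 x xs)
  have "evals p' Query (x # xs) (of_bool (p x))" if "\<forall>i<Suc x. p' i = p i" for p'
    using evals.intros(4)[of p' x xs] that by simp
  then show ?case by blast
next
  case (5 ys gs xs f z)
  obtain M where M: "\<And>p'. \<forall>i<M. p' i = p i \<Longrightarrow> evals p' f ys z"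
    using "5.IH"(2) by blast
  obtain N where N: "\<And>i p'. i < length gs \<Longrightarrow> \<forall>j<N i. p' j = p j \<Longrightarrow> evals p' (gs ! i) xs (ys ! i)"
    using "5.IH"(1) by metis
  \<comment> \<open>The sum serves as a common bound without a case split on empty
    \<open>gs\<close>.\<close>
  define B where "B = M + (\<Sum>i<length gs. N i)"
  have "M \<le> B" "\<And>i. i < length gs \<Longrightarrow> N i \<le> B"
    unfolding B_def by (auto intro!: trans_le_add2 member_le_sum)
  then have "evals p' (Comp f gs) xs z" if "\<forall>i<B. p' i = p i" for p'
    using that "5.hyps"(1) by (intro evals.intros(5)[of ys] M allI impI N) (auto dest: less_le_trans)
  then show ?case by blast
next
  case (7 f g n xs y z)
  then obtain M N where "\<And>p'. \<forall>i<M. p' i = p i \<Longrightarrow> evals p' (Rec f g) (n # xs) y"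
    "\<And>p'. \<forall>i<N. p' i = p i \<Longrightarrow> evals p' g (n # y # xs) z"
    by blast
  then have "evals p' (Rec f g) (Suc n # xs) z" if "\<forall>i<max M N. p' i = p i" for p'
    using that by (intro evals.intros(7)[of _ f g n xs y]) auto
  then show ?case by blast
next
  case (8 f n xs)
  obtain M where M: "\<And>p'. \<forall>i<M. p' i = p i \<Longrightarrow> evals p' f (n # xs) 0"
    using "8.IH"(1) by blast
  obtain N k where N: "\<And>m p'. m < n \<Longrightarrow> \<forall>i<N m. p' i = p i \<Longrightarrow> evals p' f (m # xs) (k m)"
    and k: "\<And>m. m < n \<Longrightarrow> k m > 0"
    using "8.IH"(2) by metis
  define B where "B = M + (\<Sum>m<n. N m)"
  have "M \<le> B" "\<And>m. m < n \<Longrightarrow> N m \<le> B"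
    unfolding B_def by (auto intro!: trans_le_add2 member_le_sum)
  then have "evals p' (Mu f) xs n" if "\<forall>i<B. p' i = p i" for p'
    using that k M N by (intro evals.intros(8) allI impI) (meson less_le_trans)+
  then show ?case by blast
qed (blast intro: evals.intros(1-3,6))+

lemma evals_deterministic:
  assumes "evals p c xs y" "evals p c xs y'"
  shows "y = y'"
  using assms
proof (induction arbitrary: y')
  case (1 xs)
  then show ?case by cases simp
next
  case (2 x xs)
  then show ?case by cases simp
next
  case (3 i xs)
  from "3.prems" show ?case by cases simp
next
  case (4 x xs)
  then show ?case by cases simp
next
  case (5 ys gs xs f z)
  from "5.prems" obtain ys' where ys': "length ys' = length gs"
    "\<forall>i<length gs. evals p (gs ! i) xs (ys' ! i)" "evals p f ys' y'"
    by cases auto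
  then have "ys' = ys"
    using "5.IH"(1) "5.hyps"(1) by (intro nth_equalityI) auto
  then show ?case
    using "5.IH"(2) ys'(3) by blast
next
  case (6 f xs y g)
  from "6.prems" show ?case
    by cases (use "6.IH" in blast)
next
  case (7 f g n xs y z)
  from "7.prems" show ?case
    by cases (use "7.IH" in blast)
next
  case (8 f n xs)
  from "8.prems" have *: "evals p f (y' # xs) 0 \<and> (\<forall>m<y'. \<exists>k>0. evals p f (m # xs) k)"
    by cases blast
  \<comment> \<open>At the smaller of two distinct outputs one derivation yields \<open>0\<close>
    and the other a positive value, against the induction hypothesis.\<close>
  show ?case
  proof (rule linorder_cases)
    assume "n < y'"
    then show ?thesis
      using * "8.IH"(1) by blast
  next
    assume "y' < n"
    then show ?thesis
      using * "8.IH"(2) by blast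
  qed
qed

text \<open>The computation of bit \<open>k\<close> transfers from \<open>p\<close> to
  \<open>p'\<close>, and determinism identifies its result with bit \<open>k\<close> of
  \<open>q'\<close>. Only \<open>p'\<close> in the domain are compared, since the program is
  unconstrained elsewhere.\<close>

lemma computable_partial_finite_use:
  assumes "computable_partial F" "F p = Some q"
  obtains N where "\<And>p' q'. F p' = Some q' \<Longrightarrow> \<forall>i<N. p' i = p i \<Longrightarrow> q' k = q k"
proof -
  obtain c where c: "\<And>p q n. F p = Some q \<Longrightarrow> evals p c [n] (of_bool (q n))"
    using assms unfolding computable_partial_def by blast
  obtain N where N: "\<And>p'. \<forall>i<N. p' i = p i \<Longrightarrow> evals p' c [k] (of_bool (q k))"
    using evals_finite_use[OF c[OF assms(2), of k]] by blast
  have "q' k = q k" if "F p' = Some q'" "\<forall>i<N. p' i = p i" for p' q'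
    using evals_deterministic[OF c[OF that(1)] N[OF that(2)]] by (simp only: of_bool_eq_iff)
  then show thesis
    using that by blast
qed


subsection \<open>Plays\<close>

primrec play_prefix :: "(nat list \<Rightarrow> nat) \<Rightarrow> nat \<Rightarrow> nat list" where
  "play_prefix s 0 = []"
| "play_prefix s (Suc n) = play_prefix s n @ [s (play_prefix s n)]"

definition play :: "(nat list \<Rightarrow> nat) \<Rightarrow> nat \<Rightarrow> nat" where
  "play s n = s (play_prefix s n)"

lemma play_prefix_eq: "play_prefix s n = map (play s) [0..<n]"
  by (induction n) (simp_all add: play_def)

lemma play_eq: "play s n = s (map (play s) [0..<n])"
  by (simp add: play_def flip: play_prefix_eq)

text \<open>Causality: a move depends only on how earlier positions were answered. This makes the
  maps induced by strategies continuous.\<close>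

lemma play_finite_use:
  assumes "\<And>xs. length xs \<le> n \<Longrightarrow> s xs = s' xs"
  shows "play s n = play s' n"
proof -
  have len: "length (play_prefix s m) = m" for s m
    by (induction m) auto
  have "m \<le> n \<Longrightarrow> play_prefix s m = play_prefix s' m" for m
    by (induction m) (use assms len in auto)
  then show ?thesis
    using assms len by (simp add: play_def)
qed

text \<open>Merging a strategy with a fixed sequence of opposing moves into one function on
  positions lets \<open>play\<close> serve both players; half the length is the round
  number.\<close>

definition I_against :: "(nat list \<Rightarrow> nat) \<Rightarrow> (nat \<Rightarrow> nat) \<Rightarrow> nat list \<Rightarrow> nat" where
  "I_against \<sigma> b xs = (if even (length xs) then \<sigma> xs else b (length xs div 2))"

definition II_against :: "(nat list \<Rightarrow> nat) \<Rightarrow> (nat \<Rightarrow> nat) \<Rightarrow> nat list \<Rightarrow> nat" where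
  "II_against \<tau> a xs = (if odd (length xs) then \<tau> xs else a (length xs div 2))"

lemma play_I_against:
  "play (I_against \<sigma> b) (2 * n) = \<sigma> (map (play (I_against \<sigma> b)) [0..<2 * n])"
  "play (I_against \<sigma> b) (2 * n + 1) = b n"
  by (subst play_eq, simp add: I_against_def)+

lemma play_II_against:
  "play (II_against \<tau> a) (2 * n + 1) = \<tau> (map (play (II_against \<tau> a)) [0..<2 * n + 1])"
  "play (II_against \<tau> a) (2 * n) = a n"
  by (subst play_eq, simp add: II_against_def)+

section \<open>Reading names off a play, and the payoff set\<close>

definition I_name :: "(nat \<Rightarrow> nat) \<Rightarrow> cantor" where
  "I_name \<alpha> n \<longleftrightarrow> \<alpha> (2 * n) \<noteq> 0"

text \<open>The move \<open>to_nat (Some (k, v))\<close> of player II announces that bit \<open>k\<close> is \<open>v\<close>; moves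
  decoding to \<open>None\<close> are passes. Announcing graph points in any order, rather than the bits
  in turn, avoids counting the moves that are not passes.\<close>

definition announces :: "(nat \<Rightarrow> nat) \<Rightarrow> nat \<Rightarrow> bool \<Rightarrow> bool" where
  "announces \<alpha> k v \<longleftrightarrow> (\<exists>n. from_nat (\<alpha> (2 * n + 1)) = Some (k, v))"

text \<open>The single biconditional demands both that every bit is announced and that no bit
  receives two values.\<close>

definition II_valid :: "(nat \<Rightarrow> nat) \<Rightarrow> bool" where
  "II_valid \<alpha> \<longleftrightarrow> (\<forall>k. announces \<alpha> k True \<longleftrightarrow> \<not> announces \<alpha> k False)"

definition II_name :: "(nat \<Rightarrow> nat) \<Rightarrow> cantor" where
  "II_name \<alpha> k \<longleftrightarrow> announces \<alpha> k True"

text \<open>All moves are legal, so faults are punished by the payoff: player I must name a point of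
  the domain, and only then does a bad or incomplete announcement cost player II the game.\<close>

definition I_wins :: "'z repspace \<Rightarrow> 'x repspace \<Rightarrow> ('z \<Rightarrow> 'x set) \<Rightarrow> (nat \<Rightarrow> nat) set" where
  "I_wins Z X f = {\<alpha>. I_name \<alpha> \<in> name_dom Z f \<and>
     \<not> (II_valid \<alpha> \<and> (I_name \<alpha>, II_name \<alpha>) \<in> name_graph Z X f)}"

lemma II_name_eqI:
  assumes "II_valid \<alpha>" "announces \<alpha> k v"
  shows "II_name \<alpha> k = v"
  using assms by (cases v) (auto simp: II_valid_def II_name_def)

lemma announces_II_name:
  assumes "II_valid \<alpha>"
  shows "announces \<alpha> k (II_name \<alpha> k)"
  using assms by (cases "II_name \<alpha> k") (auto simp: II_valid_def II_name_def)


subsection \<open>Complexity of the payoff set\<close>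

lemma continuous_I_name: "continuous_on UNIV I_name"
proof (rule continuous_on_finite_use)
  fix \<alpha> :: "nat \<Rightarrow> nat" and k
  show "\<exists>N. \<forall>\<alpha>'\<in>UNIV. (\<forall>i<N. \<alpha>' i = \<alpha> i) \<longrightarrow> I_name \<alpha>' k = I_name \<alpha> k"
    by (rule exI[of _ "Suc (2 * k)"]) (simp add: I_name_def)
qed

lemma measurable_announces [measurable]:
  "Measurable.pred borel (\<lambda>\<alpha>. announces \<alpha> k v)"
proof -
  have [measurable]: "(\<lambda>\<alpha> :: nat \<Rightarrow> nat. \<alpha> n) \<in> measurable borel (count_space UNIV)" for n :: nat
  proof (rule measurableI)
    fix A :: "nat set"
    have "open ((\<lambda>\<alpha> :: nat \<Rightarrow> nat. \<alpha> n) -` A)"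
      by (intro open_vimage open_discrete continuous_on_product_coordinates)
    then show "(\<lambda>\<alpha> :: nat \<Rightarrow> nat. \<alpha> n) -` A \<inter> space borel \<in> sets borel"
      by simp
  qed auto
  show ?thesis
    unfolding announces_def by measurable
qed

lemma measurable_II_valid [measurable]: "Measurable.pred borel II_valid"
  unfolding II_valid_def by measurable

text \<open>Cantor space thereby becomes second countable, so Borel measurability into it and its
  square can be checked coordinatewise.\<close>

instance bool :: second_countable_topology
proof
  show "\<exists>B :: bool set set. countable B \<and> open = generate_topology B"
    by (intro exI[of _ "range lessThan \<union> range greaterThan"]) (auto simp: open_bool_def)
qed

lemma measurable_II_name: "II_name \<in> borel_measurable borel"
proof (rule measurable_coordinatewise_then_product)
  fix k
  show "(\<lambda>\<alpha>. II_name \<alpha> k) \<in> borel_measurable borel"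
    using measurable_announces[of k True]
    by (simp only: II_name_def measurable_cong_sets[OF refl sets_borel_eq_count_space])
qed

text \<open>The payoff is a Boolean combination of a Borel set and preimages of the name domain and
  name graph. As \<open>II_name\<close> is Borel but not continuous, closure under Borel preimages
  is what applies.\<close>

lemma I_wins_in_pointclass:
  assumes "pointclass \<Gamma>" "mv_in_pointclass \<Gamma> Z X f"
  shows "I_wins Z X f \<in> \<Gamma>"
proof -
  interpret sigma_algebra UNIV \<Gamma>
    using assms by (simp add: pointclass_def)
  have I: "I_name \<in> borel_measurable borel"
    by (rule borel_measurable_continuous_onI[OF continuous_I_name])
  have "(\<lambda>\<alpha>. (I_name \<alpha>, II_name \<alpha>)) \<in> borel_measurable borel"
    by (rule borel_measurable_Pair[OF I measurable_II_name])
  then have "I_name -` name_dom Z f \<in> \<Gamma>"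
    "(\<lambda>\<alpha>. (I_name \<alpha>, II_name \<alpha>)) -` name_graph Z X f \<in> \<Gamma>"
    using I assms(2) unfolding mv_in_pointclass_def in_pointclass_def by blast+
  moreover have "{\<alpha>. II_valid \<alpha>} \<in> \<Gamma>"
    using measurable_II_valid assms(1) unfolding pred_def pointclass_def by auto
  moreover have "I_wins Z X f = I_name -` name_dom Z f -
      ({\<alpha>. II_valid \<alpha>} \<inter> (\<lambda>\<alpha>. (I_name \<alpha>, II_name \<alpha>)) -` name_graph Z X f)"
    by (auto simp: I_wins_def)
  ultimately show ?thesis
    by (metis Diff Int)
qed


subsection \<open>Winning strategies\<close>

lemma mv_continuous_of_II_strategy:
  assumes win: "\<And>\<alpha>. \<forall>n. \<alpha> (2 * n + 1) = \<tau> (map \<alpha> [0..<2 * n + 1]) \<Longrightarrow> \<alpha> \<notin> I_wins Z X f"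
  shows "mv_continuous Z X f"
proof -
  define \<pi> where "\<pi> p = play (II_against \<tau> (\<lambda>n. of_bool (p n)))" for p :: cantor
  \<comment> \<open>Off the name domain a winning strategy may leave bits unannounced, so continuity
    is claimed only on the domain.\<close>
  define F where "F p = (if p \<in> name_dom Z f then Some (II_name (\<pi> p)) else None)" for p
  have "\<pi> p \<notin> I_wins Z X f" for p
    unfolding \<pi>_def by (intro win allI play_II_against)
  moreover have "I_name (\<pi> p) = p" for p
    by (auto simp: I_name_def \<pi>_def play_II_against)
  ultimately have *: "II_valid (\<pi> p) \<and> (p, II_name (\<pi> p)) \<in> name_graph Z X f"
    if "p \<in> name_dom Z f" for p
    using that by (simp add: I_wins_def)
  have "continuous_on (name_dom Z f) (\<lambda>p. II_name (\<pi> p))"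
  proof (rule continuous_on_finite_use)
    fix p k assume "p \<in> name_dom Z f"
    then obtain n where n: "from_nat (\<pi> p (2 * n + 1)) = Some (k, II_name (\<pi> p) k)"
      using announces_II_name * unfolding announces_def by blast
    \<comment> \<open>Player II's move in round \<open>n\<close> sees bits \<open>0\<close> to
      \<open>n\<close> of the name, hence \<open>Suc n\<close>. The same announcement then occurs
      for \<open>p'\<close>, and validity excludes a conflicting one.\<close>
    have "II_name (\<pi> p') k = II_name (\<pi> p) k"
      if "p' \<in> name_dom Z f" "\<forall>i<Suc n. p' i = p i" for p'
    proof (rule II_name_eqI)
      have "\<pi> p' (2 * n + 1) = \<pi> p (2 * n + 1)"
        unfolding \<pi>_def by (rule play_finite_use) (use that in \<open>auto simp: II_against_def\<close>)
      then show "announces (\<pi> p') k (II_name (\<pi> p) k)"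
        using n unfolding announces_def by metis
    qed (use * that in blast)
    then show "\<exists>N. \<forall>p'\<in>name_dom Z f. (\<forall>i<N. p' i = p i) \<longrightarrow> II_name (\<pi> p') k = II_name (\<pi> p) k"
      by blast
  qed
  moreover have "dom F = name_dom Z f"
    by (auto simp: F_def split: if_splits)
  ultimately have "cont_partial F"
    unfolding cont_partial_def by (simp add: F_def)
  moreover have "realizes Z X f F"
    using * by (simp add: realizes_def F_def)
  ultimately show ?thesis
    unfolding mv_continuous_def by blast
qed

text \<open>In round \<open>n\<close> player II considers the graph point coded by the first component of
  \<open>prod_decode n\<close>; thus every graph point comes up infinitely often.\<close>

definition announcement :: "(cantor \<rightharpoonup> cantor) \<Rightarrow> cantor \<Rightarrow> nat \<Rightarrow> nat" where
  "announcement F r n = (let (k, v) = from_nat (fst (prod_decode n)) in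
     if \<forall>r' q'. F r' = Some q' \<longrightarrow> (\<forall>i<n. r' i = r i) \<longrightarrow> q' k = v
     then to_nat (Some (k, v)) else to_nat (None :: (nat \<times> bool) option))"

text \<open>Finite use makes each true graph point eventually known, and a known one is true because
  \<open>r\<close> itself is a competitor. Off the domain of \<open>F\<close> announcements may
  conflict, which is harmless. The test in \<open>announcement\<close> need not be effective: the
  reduction only has to be continuous.\<close>

lemma announces_announcement:
  assumes "computable_partial F" "F r = Some q" "\<And>n. \<alpha> (2 * n + 1) = announcement F r n"
  shows "announces \<alpha> k v \<longleftrightarrow> v = q k"
proof
  assume "announces \<alpha> k v"
  then obtain n where "from_nat (announcement F r n) = Some (k, v)"
    unfolding announces_def assms(3) by blast
  then have "\<forall>r' q'. F r' = Some q' \<longrightarrow> (\<forall>i<n. r' i = r i) \<longrightarrow> q' k = v"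
    unfolding announcement_def Let_def by (simp only: split: prod.splits if_splits) simp_all
  then show "v = q k"
    using assms(2) by blast
next
  assume v: "v = q k"
  obtain N where N: "\<And>r' q'. F r' = Some q' \<Longrightarrow> \<forall>i<N. r' i = r i \<Longrightarrow> q' k = q k"
    using computable_partial_finite_use[OF assms(1,2)] by blast
  \<comment> \<open>Among the rounds devoted to \<open>(k, v)\<close>, pairing with \<open>N\<close>
    selects one that is at least \<open>N\<close>.\<close>
  define n where "n = prod_encode (to_nat (k, v), N)"
  have "N \<le> n"
    unfolding n_def by (rule le_prod_encode_2)
  have known: "\<forall>r' q'. F r' = Some q' \<longrightarrow> (\<forall>i<n. r' i = r i) \<longrightarrow> q' k = v"
    unfolding v
  proof (intro allI impI)
    fix r' q' assume "F r' = Some q'" "\<forall>i<n. r' i = r i"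
    then show "q' k = q k"
      using \<open>N \<le> n\<close> by (intro N) (auto dest: less_le_trans)
  qed
  have "from_nat (fst (prod_decode n)) = (k, v)"
    by (simp add: n_def)
  then have "announcement F r n = to_nat (Some (k, v))"
    unfolding announcement_def by (simp only: Let_def prod.case) (rule if_P[OF known])
  then have "from_nat (\<alpha> (2 * n + 1)) = Some (k, v)"
    by (simp only: assms(3) from_nat_to_nat)
  then show "announces \<alpha> k v"
    unfolding announces_def by blast
qed

lemma neq_reduction_of_I_strategy:
  assumes win: "\<And>\<alpha>. \<forall>n. \<alpha> (2 * n) = \<sigma> (map \<alpha> [0..<2 * n]) \<Longrightarrow> \<alpha> \<in> I_wins Z X f"
    and emb: "computable_embedding X Xbar \<iota>"
  shows "Problem Xbar X (\<lambda>y. {x \<in> points X. y \<noteq> \<iota> x}) \<le>\<^sub>W\<^sup>* Problem Z X f"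
proof -
  obtain F where F: "computable_partial F" "realizes Xbar X (\<lambda>y. {x \<in> points X. \<iota> x = y}) F"
    using emb unfolding computable_embedding_def mv_computable_def by blast
  define \<pi> where "\<pi> r = play (I_against \<sigma> (announcement F r))" for r
  define H where "H r = Some (I_name (\<pi> r))" for r
  \<comment> \<open>The name returned by \<open>G\<close> already solves the inequality problem, so
    it is passed on unchanged.\<close>
  define K :: "cantor \<times> cantor \<rightharpoonup> cantor" where "K = (\<lambda>(r, s). Some s)"
  have wins: "\<pi> r \<in> I_wins Z X f" for r
    unfolding \<pi>_def by (intro win allI play_I_against)
  have "continuous_on UNIV (\<lambda>r. I_name (\<pi> r))"
  proof (rule continuous_on_finite_use)
    fix r k
    \<comment> \<open>Before position \<open>2 * k\<close> player II has moved only in rounds below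
      \<open>k\<close>, inspecting fewer than \<open>k\<close> bits of \<open>r\<close>.\<close>
    have "I_name (\<pi> r') k = I_name (\<pi> r) k" if eq: "\<forall>i<k. r' i = r i" for r'
    proof -
      have "announcement F r' n = announcement F r n" if "n \<le> k" for n
        using that eq by (simp add: announcement_def cong: conj_cong)
      then have "\<pi> r' (2 * k) = \<pi> r (2 * k)"
        unfolding \<pi>_def by (intro play_finite_use) (auto simp: I_against_def)
      then show ?thesis
        by (simp add: I_name_def)
    qed
    then show "\<exists>N. \<forall>r'\<in>UNIV. (\<forall>i<N. r' i = r i) \<longrightarrow> I_name (\<pi> r') k = I_name (\<pi> r) k"
      by blast
  qed
  then have "cont_partial H"
    by (auto simp: cont_partial_def H_def intro: continuous_on_subset)
  moreover have "cont_partial K"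
    by (auto simp: cont_partial_def K_def case_prod_unfold intro: continuous_intros)
  moreover have "realizes Xbar X (\<lambda>y. {x \<in> points X. y \<noteq> \<iota> x})
      (\<lambda>r. Option.bind (H r) (\<lambda>p. Option.bind (G p) (\<lambda>s. K (r, s))))"
    if G: "realizes Z X f G" for G
    unfolding realizes_def
  proof
    fix r assume "r \<in> name_dom Xbar (\<lambda>y. {x \<in> points X. y \<noteq> \<iota> x})"
    then obtain y where y: "Xbar r = Some y"
      by (auto simp: name_dom_def)
    define p where "p = I_name (\<pi> r)"
    \<comment> \<open>A winning player I names a point of the domain whatever player II does, so
      \<open>G\<close> must answer.\<close>
    have "p \<in> name_dom Z f"
      using wins by (simp add: I_wins_def p_def)
    then obtain s where s: "G p = Some s" "(p, s) \<in> name_graph Z X f"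
      using G by (auto simp: realizes_def)
    then obtain z x where zx: "Z p = Some z" "X s = Some x" "x \<in> f z"
      by (auto simp: name_graph_def)
    have x: "x \<in> points X"
      using zx by (auto intro: ranI)
    have "y \<noteq> \<iota> x"
    proof
      assume y_eq: "y = \<iota> x"
      then have "r \<in> name_dom Xbar (\<lambda>y. {x \<in> points X. \<iota> x = y})"
        using x y by (auto simp: name_dom_def)
      then obtain q x' where q: "F r = Some q" "X q = Some x'" "x' \<in> points X" "\<iota> x' = y"
        using F(2) y unfolding realizes_def name_graph_def by fastforce
      then have "x' = x"
        using emb x y_eq by (auto simp: computable_embedding_def dest: inj_onD)
      have ann: "announces (\<pi> r) k v \<longleftrightarrow> v = q k" for k v
        by (rule announces_announcement[OF F(1) q(1)])
          (unfold \<pi>_def, rule play_I_against)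
      have "II_valid (\<pi> r)" "II_name (\<pi> r) = q"
        by (auto simp: II_valid_def II_name_def ann)
      moreover have "(p, q) \<in> name_graph Z X f"
        using zx q \<open>x' = x\<close> by (auto simp: name_graph_def)
      ultimately show False
        using wins[of r] by (simp add: I_wins_def p_def)
    qed
    then have "(r, s) \<in> name_graph Xbar X (\<lambda>y. {x \<in> points X. y \<noteq> \<iota> x})"
      using x y zx by (auto simp: name_graph_def)
    then show "\<exists>q. Option.bind (H r) (\<lambda>p. Option.bind (G p) (\<lambda>s. K (r, s))) = Some q \<and>
        (r, q) \<in> name_graph Xbar X (\<lambda>y. {x \<in> points X. y \<noteq> \<iota> x})"
      using s by (simp add: H_def K_def p_def)
  qed
  ultimately show ?thesis
    by auto
qed

text \<open>Here the inequality problem is \<open>Infty\<close>, which reduces to no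
  \<open>Problem\<close>, so continuity must hold outright; a constant realizer gives it.\<close>

lemma mv_continuous_singleton:
  assumes "multivalued Z X f" "is_singleton (points X)"
  shows "mv_continuous Z X f"
proof -
  obtain x where x: "points X = {x}"
    using assms(2) by (auto simp: is_singleton_def)
  then obtain q where q: "X q = Some x"
    by (auto simp: ran_def)
  have "x \<in> f z" if "Z p = Some z" "f z \<noteq> {}" for p z
    using assms(1) x that unfolding multivalued_def by (metis ranI subset_singletonD insertI1)
  then have "realizes Z X f (\<lambda>_. Some q)"
    using q by (auto simp: realizes_def name_dom_def name_graph_def)
  moreover have "cont_partial (\<lambda>_. Some q)"
    by (simp add: cont_partial_def)
  ultimately show ?thesis
    unfolding mv_continuous_def by blast
qed

theorem theorem18:
  fixes Z :: "'z repspace" and X :: "'x repspace" and Xbar :: "'y repspace"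
    and \<iota> :: "'x \<Rightarrow> 'y" and f :: "'z \<Rightarrow> 'x set" and \<Gamma> :: "(nat \<Rightarrow> nat) set set"
  assumes "pointclass \<Gamma>" and "determinacy \<Gamma>"
    and "multivalued Z X f" and "mv_in_pointclass \<Gamma> Z X f"
    and "is_completion X Xbar \<iota>"
  shows "mv_continuous Z X f \<or> neq_problem X Xbar \<iota> \<le>\<^sub>W\<^sup>* Problem Z X f"
proof (cases "is_singleton (points X)")
  case True
  then show ?thesis
    using mv_continuous_singleton assms(3) by blast
next
  \<comment> \<open>This case includes empty \<open>points X\<close>, where the inequality problem
    is nowhere defined; the same game covers it.\<close>
  case False
  have emb: "computable_embedding X Xbar \<iota>"
    using assms(5) by (simp add: is_completion_def)
  have "determined (I_wins Z X f)"
    using I_wins_in_pointclass[OF assms(1,4)] assms(2) by (simp add: determinacy_def)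
  then show ?thesis
    unfolding determined_def
  proof (elim disjE exE)
    fix \<sigma> assume "\<forall>\<alpha>. (\<forall>n. \<alpha> (2 * n) = \<sigma> (map \<alpha> [0..<2 * n])) \<longrightarrow> \<alpha> \<in> I_wins Z X f"
    then have "Problem Xbar X (\<lambda>y. {x \<in> points X. y \<noteq> \<iota> x}) \<le>\<^sub>W\<^sup>* Problem Z X f"
      by (intro neq_reduction_of_I_strategy[OF _ emb]) (erule allE, erule mp)
    then show ?thesis
      by (simp only: neq_problem_def False if_False simp_thms)
  next
    fix \<tau> assume "\<forall>\<alpha>. (\<forall>n. \<alpha> (2 * n + 1) = \<tau> (map \<alpha> [0..<2 * n + 1])) \<longrightarrow> \<alpha> \<notin> I_wins Z X f"
    then have "mv_continuous Z X f"
      by (intro mv_continuous_of_II_strategy) (erule allE, erule mp)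
    then show ?thesis ..
  qed
qed

end
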